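(* Let $M>1$, $\mathcal R=[1/M,M]$ and $\phi_1(t,x)=\dfrac{x-1}{2+(t+1)(x-1)}$. Put $$\rho=\frac{M+1}{M-1}+\frac{2}{\sqrt M},\qquad L=\frac{1}{\frac{M+1}{M-1}-\frac{\rho}{2}-\frac{\rho^{-1}}{2}} .$$ Then $\rho>1$, $0<L<\infty$, and $|\phi_1(z,x)|\le L$ for all $x\in\mathcal R$ and all $z=\frac{\rho}{2}e^{i\theta}+\frac{\rho^{-1}}{2}e^{-i\theta}$, $\theta\in[0,2\pi]$. Moreover, for every $\epsilon>0$ one can choose a number of points $N=O\big(\sqrt M\,\log(\sqrt{M^3/\epsilon})\big)$ such that $$\operatorname{hyp}\log(-\epsilon)\subseteq\hat H_{\phi_1,N}\subseteq\operatorname{hyp}\log(\epsilon),$$ where, with $\{t_k\}_{k\in[N]}$, $\{w_k\}_{k\in[N]}$ the nodes and weights of $N$-point Gaussian quadrature on $[-1,1]$, $\hat H_{\phi_1,N}$ is the set of $(x,\nu)\in\mathcal R\times\mathbb R$ for which there exist $v_k,r_{1k},r_{2k}\in\mathbb R$ ($k\in[N]$) with $$\sum_{k\in[N]}w_kv_k\ge\nu,$$ $$r_{1k}=1-(t_k+1)v_k\ge0,\quad r_{2k}=(x-1)-2v_k\ge0,\quad \big(v_k\sqrt{8(t_k+1)},\,r_{1k}-r_{2k},\,r_{1k}+r_{2k}\big)\in\mathcal L_3\quad\forall k\in[N].$$ In particular $\hat H_{\phi_1,N}$ is represented with $O(\sqrt M\log(\sqrt{M^3/\epsilon}))$ variables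 and second-order conic constraints.
   Context: $[N]=\{1,\dots,N\}$; $\mathcal L_3=\{y\in\mathbb R^3:y_3\ge\sqrt{y_1^2+y_2^2}\}$; for $\alpha\in\mathbb R$, $\operatorname{hyp}\log(\alpha)=\{(x,\nu)\in\mathcal R\times\mathbb R:\log(x)\ge\nu-\alpha\}$. Gaussian quadrature is Gauss–Legendre quadrature. $O(\cdot)$ is the usual asymptotic notation, describing growth in $M$ and $1/\epsilon$. *)

theory Defs
  imports
    "HOL-Analysis.Analysis"
    "HOL-Computational_Algebra.Polynomial"
    "HOL-Library.Landau_Symbols"
begin

section \<open>Gauss--Legendre quadrature on \<open>[-1,1]\<close>\<close>

text \<open>Rodrigues' formula.\<close>

definition legendre :: "nat \<Rightarrow> real poly" where
  "legendre N = smult (1 / (2 ^ N * fact N)) ((pderiv ^^ N) ([:-1, 0, 1:] ^ N))"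

text \<open>
  The nodes are the \<open>N\<close> real roots of the Legendre polynomial of degree \<open>N\<close>, in increasing order
  and indexed by \<open>k \<in> {1..N}\<close>; the weights are the integrals of the Lagrange basis polynomials at
  these nodes.
\<close>

definition gl_node :: "nat \<Rightarrow> nat \<Rightarrow> real" where
  "gl_node N k = sorted_list_of_set {t. poly (legendre N) t = 0} ! (k - 1)"

definition gl_weight :: "nat \<Rightarrow> nat \<Rightarrow> real" where
  "gl_weight N k =
     integral {-1..1} (\<lambda>t. \<Prod>j\<in>{1..N} - {k}. (t - gl_node N j) / (gl_node N k - gl_node N j))"


section \<open>The kernel, the ellipse parameter and the bound\<close>

definition range_R :: "real \<Rightarrow> real set" where
  "range_R M = {1 / M..M}"

definition phi1 :: "'a::field \<Rightarrow> 'a \<Rightarrow> 'a" where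
  "phi1 t x = (x - 1) / (2 + (t + 1) * (x - 1))"

definition rho :: "real \<Rightarrow> real" where
  "rho M = (M + 1) / (M - 1) + 2 / sqrt M"

definition bound_L :: "real \<Rightarrow> real" where
  "bound_L M = 1 / ((M + 1) / (M - 1) - rho M / 2 - inverse (rho M) / 2)"

definition ellipse_point :: "real \<Rightarrow> real \<Rightarrow> complex" where
  "ellipse_point r \<theta> =
     of_real (r / 2) * exp (\<i> * of_real \<theta>) + of_real (inverse r / 2) * exp (- \<i> * of_real \<theta>)"


section \<open>Hypographs and the approximating set\<close>

definition hyp_log :: "real \<Rightarrow> real \<Rightarrow> (real \<times> real) set" where
  "hyp_log M \<alpha> = {(x, \<nu>). x \<in> range_R M \<and> ln x \<ge> \<nu> - \<alpha>}"

definition lorentz3 :: "(real ^ 3) set" where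
  "lorentz3 = {y. y $ 3 \<ge> sqrt ((y $ 1)\<^sup>2 + (y $ 2)\<^sup>2)}"

definition hatH :: "real \<Rightarrow> nat \<Rightarrow> (real \<times> real) set" where
  "hatH M N = {(x, \<nu>). x \<in> range_R M \<and>
     (\<exists>v r1 r2 :: nat \<Rightarrow> real.
        (\<Sum>k\<in>{1..N}. gl_weight N k * v k) \<ge> \<nu> \<and>
        (\<forall>k\<in>{1..N}.
           r1 k = 1 - (gl_node N k + 1) * v k \<and> r1 k \<ge> 0 \<and>
           r2 k = (x - 1) - 2 * v k \<and> r2 k \<ge> 0 \<and>
           vector [v k * sqrt (8 * (gl_node N k + 1)), r1 k - r2 k, r1 k + r2 k] \<in> lorentz3))}"


section \<open>Second-order conic systems and their size\<close>

text \<open>\<open>Affine c [(a\<^sub>1, u\<^sub>1), \<dots>]\<close> stands for the affine form \<open>c + a\<^sub>1 u\<^sub>1 + \<dots>\<close>.\<close>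

datatype 'v affine = Affine real "(real \<times> 'v) list"

fun affine_val :: "('v \<Rightarrow> real) \<Rightarrow> 'v affine \<Rightarrow> real" where
  "affine_val \<sigma> (Affine c l) = c + (\<Sum>(a, u)\<leftarrow>l. a * \<sigma> u)"

datatype 'v soc_constraint =
    Eq0 "'v affine"
  | Ge0 "'v affine"
  | InL3 "'v affine" "'v affine" "'v affine"

fun sat :: "('v \<Rightarrow> real) \<Rightarrow> 'v soc_constraint \<Rightarrow> bool" where
  "sat \<sigma> (Eq0 e) \<longleftrightarrow> affine_val \<sigma> e = 0"
| "sat \<sigma> (Ge0 e) \<longleftrightarrow> affine_val \<sigma> e \<ge> 0"
| "sat \<sigma> (InL3 e f g) \<longleftrightarrow> vector [affine_val \<sigma> e, affine_val \<sigma> f, affine_val \<sigma> g] \<in> lorentz3"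

definition system_vars :: "'v soc_constraint list \<Rightarrow> 'v set" where
  "system_vars cs = (\<Union>c\<in>set cs. set_soc_constraint c)"

text \<open>The set is the projection of the solution set of \<open>cs\<close> to the variables \<open>p\<close> and \<open>q\<close>.\<close>

definition soc_represents ::
    "'v soc_constraint list \<Rightarrow> 'v \<Rightarrow> 'v \<Rightarrow> (real \<times> real) set \<Rightarrow> bool" where
  "soc_represents cs p q S \<longleftrightarrow> S = {(\<sigma> p, \<sigma> q) | \<sigma>. \<forall>c\<in>set cs. sat \<sigma> c}"

datatype hvar = X | Nu | V nat | R1 nat | R2 nat

text \<open>The system of constraints in the definition of \<^const>\<open>hatH\<close>, including \<open>1/M \<le> x \<le> M\<close>.\<close>

definition hatH_system :: "real \<Rightarrow> nat \<Rightarrow> hvar soc_constraint list" where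
  "hatH_system M N =
     [Ge0 (Affine (- 1 / M) [(1, X)]),
      Ge0 (Affine M [(- 1, X)]),
      Ge0 (Affine 0 ((- 1, Nu) # map (\<lambda>k. (gl_weight N k, V k)) [1..<Suc N]))] @
     concat (map (\<lambda>k.
       [Eq0 (Affine (- 1) [(1, R1 k), (gl_node N k + 1, V k)]),
        Ge0 (Affine 0 [(1, R1 k)]),
        Eq0 (Affine 1 [(1, R2 k), (- 1, X), (2, V k)]),
        Ge0 (Affine 0 [(1, R2 k)]),
        InL3 (Affine 0 [(sqrt (8 * (gl_node N k + 1)), V k)])
             (Affine 0 [(1, R1 k), (- 1, R2 k)])
             (Affine 0 [(1, R1 k), (1, R2 k)])]) [1..<Suc N])"


section \<open>The asymptotic regime\<close>

text \<open>
  Estimates \<open>O(\<dots>)\<close> in \<open>M\<close> and \<open>1/\<epsilon>\<close> are uniform over all \<open>M > 1\<close>, \<open>\<epsilon> > 0\<close> with \<open>M\<^sup>3/\<epsilon>\<close> large. Some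
  lower bound on \<open>M\<^sup>3/\<epsilon>\<close> is needed because \<open>log \<surd>(M\<^sup>3/\<epsilon>)\<close> vanishes for \<open>\<epsilon> = M\<^sup>3\<close>. The regimes
  \<open>M \<rightarrow> \<infinity>\<close> and \<open>\<epsilon> \<rightarrow> 0\<close> jointly, or one of them with the other parameter fixed, are special cases.
\<close>

definition growth :: "(real \<times> real) filter" where
  "growth = inf (principal ({1<..} \<times> {0<..})) (filtercomap (\<lambda>(M, \<epsilon>). M ^ 3 / \<epsilon>) at_top)"

lemma eventually_growth:
  "eventually P growth \<longleftrightarrow> (\<exists>K. \<forall>M>1. \<forall>\<epsilon>>0. M ^ 3 / \<epsilon> \<ge> K \<longrightarrow> P (M, \<epsilon>))"
proof -
  have "eventually P growth \<longleftrightarrow>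
      (\<exists>K. \<forall>z. (case z of (M, \<epsilon>) \<Rightarrow> M ^ 3 / \<epsilon>) \<ge> K \<longrightarrow> z \<in> {1<..} \<times> {0<..} \<longrightarrow> P z)"
    unfolding growth_def inf_commute[of "principal _"] eventually_inf_principal
      eventually_filtercomap_at_top_linorder ..
  also have "\<dots> \<longleftrightarrow> (\<exists>K. \<forall>M>1. \<forall>\<epsilon>>0. M ^ 3 / \<epsilon> \<ge> K \<longrightarrow> P (M, \<epsilon>))"
    unfolding split_paired_All mem_Times_iff fst_conv snd_conv prod.case greaterThan_iff
    by (rule arg_cong[where f = Ex]) blast
  finally show ?thesis .
qed

lemma prod_filter_le_growth: "at_top \<times>\<^sub>F at_right 0 \<le> growth"
proof (rule filter_leI)
  fix P assume "eventually P growth"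
  then obtain K where K: "\<And>M \<epsilon>. M > 1 \<Longrightarrow> \<epsilon> > 0 \<Longrightarrow> M ^ 3 / \<epsilon> \<ge> K \<Longrightarrow> P (M, \<epsilon>)"
    unfolding eventually_growth by blast
  have M: "\<forall>\<^sub>F M in at_top. (M::real) > max 1 \<bar>K\<bar>" by (rule eventually_gt_at_top)
  have e: "\<forall>\<^sub>F \<epsilon> in at_right (0::real). \<epsilon> \<in> {0<..<1}"
    by (rule eventually_at_right_real) simp
  have "P (M, \<epsilon>)" if "M > max 1 \<bar>K\<bar>" "\<epsilon> \<in> {0<..<1}" for M \<epsilon>
  proof (rule K)
    have "M \<le> M ^ 3" using that by (simp add: self_le_power)
    moreover have "M ^ 3 * \<epsilon> \<le> M ^ 3 * 1" using that by (intro mult_left_mono) auto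
    then have "M ^ 3 \<le> M ^ 3 / \<epsilon>" using that by (simp add: pos_le_divide_eq)
    ultimately show "M ^ 3 / \<epsilon> \<ge> K" using that by linarith
  qed (use that in auto)
  then show "eventually P (at_top \<times>\<^sub>F at_right 0)"
    unfolding eventually_prod_filter using M e by blast
qed

end

theory Submission
  imports Defs
begin

text \<open>
  For \<open>x > 0\<close>, \<open>\<integral> phi1 t x dt\<close> over \<open>[-1,1]\<close> is \<open>ln x\<close>, and the conic constraints at the node
  \<open>t\<^sub>k\<close> say that \<open>v\<^sub>k \<le> phi1 t\<^sub>k x\<close>. As the Gauss weights are nonnegative, \<open>hatH M N\<close> is the hypograph of
  the \<open>N\<close>-point Gauss approximation of \<open>ln\<close>. Gauss quadrature is exact in degree \<open>< 2N\<close> and its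
  weights sum to \<open>2\<close>, so its error is at most \<open>4\<close> times the distance of \<open>phi1 _ x\<close> to a polynomial of
  that degree. Since \<open>phi1 _ x\<close> has a single pole, an explicit approximation built from the Chebyshev
  polynomial \<open>T\<^sub>2\<^sub>N\<close> has error at most \<open>M exp (-2N/\<surd>M)\<close>; hence \<open>N \<ge> \<surd>M/2 ln (4M/\<epsilon>)\<close> points suffice.
  This replaces the general contour-integral error bound on the ellipse.
\<close>

section \<open>Gauss--Legendre quadrature\<close>

text \<open>Rolle's theorem between consecutive zeros, by adding a new largest zero at each step.
  That \<open>T\<close> lies strictly between elements of \<open>S\<close> keeps each new zero
  distinct from the earlier ones and later confines the zeros to the open interval.\<close>

lemma poly_Rolle_roots:
  fixes p :: "real poly"
  assumes "finite S" "\<And>x. x \<in> S \<Longrightarrow> poly p x = 0"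
  shows "\<exists>T. finite T \<and> card S \<le> card T + 1 \<and>
    (\<forall>z\<in>T. poly (pderiv p) z = 0 \<and> (\<exists>a\<in>S. \<exists>b\<in>S. a < z \<and> z < b))"
  using assms
proof (induction S rule: finite_linorder_max_induct)
  case empty
  show ?case by (intro exI[of _ "{}"]) auto
next
  case (insert b S)
  then obtain T where T: "finite T" "card S \<le> card T + 1"
    "\<And>z. z \<in> T \<Longrightarrow> poly (pderiv p) z = 0" "\<And>z. z \<in> T \<Longrightarrow> \<exists>a\<in>S. \<exists>b\<in>S. a < z \<and> z < b"
    by auto
  show ?case
  proof (cases "S = {}")
    case True
    then show ?thesis by (intro exI[of _ "{}"]) auto
  next
    case False
    define m where "m = Max S"
    have m: "m \<in> S" "m < b" "\<And>s. s \<in> S \<Longrightarrow> s \<le> m"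
      using False insert by (auto simp: m_def)
    obtain z where z: "m < z" "z < b" "poly (pderiv p) z = 0"
      using poly_MVT[of m b p] m insert.prems by auto
    have "z \<notin> T" using T(4) z(1) m(3) by fastforce
    moreover have "card (insert b S) = card S + 1"
      using insert.hyps by (subst card_insert_disjoint) auto
    moreover have "\<exists>a\<in>insert b S. \<exists>c\<in>insert b S. a < y \<and> y < c" if "y \<in> insert z T" for y
      using that T(4) z m(1) by blast
    ultimately show ?thesis
      using T(1-3) z(3) by (intro exI[of _ "insert z T"]) auto
  qed
qed

text \<open>By the product rule, each differentiation costs at most one factor
  \<open>p\<close>.\<close>

lemma power_dvd_higher_pderiv:
  fixes p :: "'a::idom poly"
  shows "k \<le> n \<Longrightarrow> p ^ (n - k) dvd (pderiv ^^ k) (p ^ n)"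
proof (induction k)
  case (Suc k)
  \<comment> \<open>Writing the exponent as a successor makes the power rule
    \<open>pderiv_power_Suc\<close> applicable.\<close>
  then obtain q where q: "(pderiv ^^ k) (p ^ n) = p ^ Suc (n - Suc k) * q"
    by (metis Suc_diff_Suc Suc_le_lessD dvdE less_imp_le)
  show ?case
    by (simp only: funpow.simps o_apply q pderiv_mult pderiv_power_Suc)
      (intro dvd_add dvd_mult2[OF dvd_smult] dvd_mult[OF dvd_mult2[OF dvd_smult]]
        dvd_mult2[OF le_imp_power_dvd]; simp)
qed simp

text \<open>A positive power of t^2 - 1 survives in the derivative. This vanishing serves twice: it
  supplies two extra zeros for Rolle's theorem, and it removes the boundary terms when integrating
  by parts.\<close>

lemma poly_higher_pderiv_endpoints:
  assumes "k < n" "\<bar>x\<bar> = (1::real)"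
  shows "poly ((pderiv ^^ k) ([:-1, 0, 1:] ^ n)) x = 0"
proof -
  obtain q where q: "(pderiv ^^ k) ([:-1, 0, 1:] ^ n) = [:-1, 0, 1:] ^ (n - k) * (q :: real poly)"
    using power_dvd_higher_pderiv[of k n "[:-1, 0, 1::real:]"] assms by (auto elim: dvdE)
  have "x * x = 1" using assms(2) by (auto simp: abs_if split: if_splits)
  then show ?thesis using assms(1) by (simp add: q)
qed

text \<open>For k < n, k interior zeros together with the endpoints are k + 2 zeros, so Rolle's
  theorem yields k + 1 interior zeros of the next derivative.\<close>

lemma higher_pderiv_many_roots:
  assumes "k \<le> n"
  shows "\<exists>S. finite S \<and> card S \<ge> k \<and> S \<subseteq> {-1<..<1} \<and>
    (\<forall>z\<in>S. poly ((pderiv ^^ k) ([:-1, 0, 1:] ^ n)) z = (0::real))"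
  using assms
proof (induction k)
  case 0
  show ?case by (intro exI[of _ "{}"]) auto
next
  case (Suc k)
  let ?p = "(pderiv ^^ k) ([:-1, 0, 1:] ^ n) :: real poly"
  obtain S where S: "finite S" "card S \<ge> k" "S \<subseteq> {-1<..<1}" "\<And>z. z \<in> S \<Longrightarrow> poly ?p z = 0"
    using Suc by auto
  have c: "card (insert (-1) (insert 1 S)) = card S + 2"
    using S by (subst card_insert_disjoint, simp, force, subst card_insert_disjoint) auto
  have roots: "poly ?p x = 0" if "x \<in> insert (-1) (insert 1 S)" for x
    using that S(4) poly_higher_pderiv_endpoints[of k n] Suc.prems by auto
  obtain T where T: "finite T" "card S + 2 \<le> card T + 1"
    "\<And>z. z \<in> T \<Longrightarrow> poly (pderiv ?p) z = 0"
    "\<And>z. z \<in> T \<Longrightarrow> \<exists>a\<in>insert (-1) (insert 1 S). \<exists>b\<in>insert (-1) (insert 1 S). a < z \<and> z < b"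
    using poly_Rolle_roots[of "insert (-1) (insert 1 S)" ?p] roots S(1) unfolding c by auto
  have "T \<subseteq> {-1<..<1}"
  proof
    fix z assume "z \<in> T"
    then obtain a b where "a \<in> insert (-1) (insert 1 S)" "b \<in> insert (-1) (insert 1 S)"
      "a < z" "z < b" using T(4) by blast
    moreover have "insert (-1) (insert 1 S) \<subseteq> {-1..1}" using S(3) by auto
    ultimately show "z \<in> {-1<..<1}" by fastforce
  qed
  then show ?case using T S(2) by (intro exI[of _ T]) auto
qed

lemma degree_legendre: "degree (legendre N) = N"
  by (simp add: legendre_def degree_higher_pderiv degree_power_eq)

text \<open>The N interior zeros found by Rolle's theorem exhaust the zeros, because the degree
  allows no more.\<close>

lemma legendre_roots:
  shows "finite {t. poly (legendre N) t = 0}"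
    and "card {t. poly (legendre N) t = 0} = N"
    and "{t. poly (legendre N) t = 0} \<subseteq> {-1<..<1}"
proof -
  let ?Z = "{t. poly (legendre N) t = 0}"
  have nz: "legendre N \<noteq> 0"
  proof (cases N)
    case 0 then show ?thesis by (simp add: legendre_def)
  next
    case (Suc m) then show ?thesis using degree_legendre[of N] by auto
  qed
  show fin: "finite ?Z" using nz by (rule poly_roots_finite)
  obtain S where S: "finite S" "card S \<ge> N" "S \<subseteq> {-1<..<1}"
    "\<And>z. z \<in> S \<Longrightarrow> poly (legendre N) z = 0"
    using higher_pderiv_many_roots[of N N] by (auto simp: legendre_def)
  have "S \<subseteq> ?Z" using S(4) by auto
  moreover have le: "card ?Z \<le> N"
    using card_poly_roots_bound[OF nz] by (simp add: degree_legendre)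
  ultimately have "S = ?Z" using S(2) fin by (intro card_seteq) auto
  then show "card ?Z = N" "?Z \<subseteq> {-1<..<1}" using S(2,3) le by auto
qed

lemma gl_node_bij: "bij_betw (gl_node N) {1..N} {t. poly (legendre N) t = 0}"
proof -
  let ?Z = "{t. poly (legendre N) t = 0}"
  have "bij_betw ((!) (sorted_list_of_set ?Z)) {..<N} ?Z"
    using legendre_roots[of N] by (intro bij_betw_nth) auto
  moreover have "bij_betw (\<lambda>k. k - 1) {1..N} {..<N}"
    by (rule bij_betwI[of _ _ _ Suc]) auto
  ultimately have "bij_betw ((!) (sorted_list_of_set ?Z) \<circ> (\<lambda>k. k - 1)) {1..N} ?Z"
    by (intro bij_betw_trans)
  then show ?thesis by (simp add: gl_node_def[abs_def] o_def)
qed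

lemma gl_node_inj: "inj_on (gl_node N) {1..N}"
  using gl_node_bij by (rule bij_betw_imp_inj_on)

lemma gl_node_root: "k \<in> {1..N} \<Longrightarrow> poly (legendre N) (gl_node N k) = 0"
  using bij_betwE[OF gl_node_bij] by blast

lemma gl_node_bounds: "k \<in> {1..N} \<Longrightarrow> -1 < gl_node N k \<and> gl_node N k < 1"
  using gl_node_root legendre_roots(3) by fastforce

section \<open>Orthogonality of the Legendre polynomials\<close>

lemma integrable_poly [simp, intro]: "poly (p :: real poly) integrable_on {a..b}"
  by (intro integrable_continuous_interval continuous_intros)

lemma integral_pderiv:
  assumes "a \<le> b"
  shows "integral {a..b} (poly (pderiv p)) = poly p b - poly (p :: real poly) a"
proof (rule integral_unique, rule fundamental_theorem_of_calculus[OF assms])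
  show "(poly p has_vector_derivative poly (pderiv p) x) (at x within {a..b})" for x
    by (metis has_real_derivative_iff_has_vector_derivative poly_DERIV has_field_derivative_at_within)
qed

text \<open>Integration by parts moves one derivative onto \<open>q\<close> and so lowers its
  degree; the boundary terms vanish because fewer than \<open>n\<close> derivatives are left on the
  power.\<close>

lemma integral_higher_pderiv_mult:
  assumes "k \<le> n" "degree q < k"
  shows "integral {-1..1} (poly ((pderiv ^^ k) ([:-1, 0, 1:] ^ n) * q)) = (0::real)"
  using assms
proof (induction k arbitrary: q)
  case (Suc k)
  let ?p = "(pderiv ^^ k) ([:-1, 0, 1:] ^ n) :: real poly"
  have IH: "integral {-1..1} (poly (?p * pderiv q)) = 0"
  proof (cases "degree q = 0")
    \<comment> \<open>A constant \<open>q\<close> is separate: differentiation does not lower its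
      degree below 0, so the induction hypothesis would fail to apply at k = 0.\<close>
    case True
    then have "pderiv q = 0" by (simp add: pderiv_eq_0_iff)
    then have "poly (?p * pderiv q) = (\<lambda>_. 0)" by (simp add: fun_eq_iff)
    then show ?thesis by simp
  next
    case False
    then show ?thesis using Suc by (intro Suc.IH) (auto simp: degree_pderiv)
  qed
  have "integral {-1..1} (poly (pderiv (?p * q))) = 0"
    using Suc.prems by (simp add: integral_pderiv poly_higher_pderiv_endpoints)
  moreover have "poly (pderiv (?p * q)) = (\<lambda>x. poly (?p * pderiv q) x + poly (pderiv ?p * q) x)"
    by (rule ext) (simp add: pderiv_mult mult.commute)
  ultimately show ?case using IH
    by (simp add: integral_add[OF integrable_poly integrable_poly] del: poly_mult)
qed simp

lemma legendre_orthogonal: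
  assumes "degree q < N"
  shows "integral {-1..1} (poly (legendre N * q)) = 0"
proof -
  have "poly (legendre N * q) =
      (\<lambda>x. 1 / (2 ^ N * fact N) * poly ((pderiv ^^ N) ([:-1, 0, 1:] ^ N) * q) x)"
    by (rule ext) (simp add: legendre_def)
  then show ?thesis
    using integral_higher_pderiv_mult[OF order_refl assms] by (simp del: poly_mult)
qed

section \<open>Lagrange interpolation, exactness and error of the Gauss rule\<close>

text \<open>The integrand of \<open>gl_weight\<close> as a formal polynomial, so that its degree can
  be bounded.\<close>

definition lagrange_poly :: "nat \<Rightarrow> nat \<Rightarrow> real poly" where
  "lagrange_poly N k =
     (\<Prod>j\<in>{1..N} - {k}. smult (1 / (gl_node N k - gl_node N j)) [:- gl_node N j, 1:])"

lemma poly_lagrange_poly: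
  "poly (lagrange_poly N k) t =
     (\<Prod>j\<in>{1..N} - {k}. (t - gl_node N j) / (gl_node N k - gl_node N j))"
  by (simp add: lagrange_poly_def poly_prod diff_divide_distrib)

lemma degree_lagrange_poly:
  assumes "k \<in> {1..N}"
  shows "degree (lagrange_poly N k) < N"
proof -
  have "degree (lagrange_poly N k) \<le> (\<Sum>j\<in>{1..N} - {k}.
      degree (smult (1 / (gl_node N k - gl_node N j)) [:- gl_node N j, 1:]))"
    unfolding lagrange_poly_def by (rule order_trans[OF degree_prod_sum_le]) (auto simp: o_def)
  also have "\<dots> \<le> (\<Sum>j\<in>{1..N} - {k}. 1)" by (intro sum_mono) auto
  also have "\<dots> < N" using assms by auto
  finally show ?thesis .
qed

lemma lagrange_poly_node:
  assumes "k \<in> {1..N}" "i \<in> {1..N}"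
  shows "poly (lagrange_poly N k) (gl_node N i) = (if i = k then 1 else 0)"
proof (cases "i = k")
  case True
  have "gl_node N k \<noteq> gl_node N j" if "j \<in> {1..N} - {k}" for j
    using that assms(1) gl_node_inj[of N] by (auto dest: inj_onD)
  then show ?thesis using True by (simp add: poly_lagrange_poly)
next
  case False
  then show ?thesis using assms
    by (auto simp: poly_lagrange_poly intro!: prod_zero bexI[of _ i])
qed

lemma gl_weight_eq: "gl_weight N k = integral {-1..1} (poly (lagrange_poly N k))"
  by (simp add: gl_weight_def poly_lagrange_poly[abs_def])

text \<open>A polynomial of degree below N equals its Lagrange interpolant \<open>r\<close>, since
  both agree at N distinct nodes; integrate termwise.\<close>

lemma gl_exact_low:
  assumes "degree p < N"
  shows "integral {-1..1} (poly p) = (\<Sum>k\<in>{1..N}. gl_weight N k * poly p (gl_node N k))"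
proof -
  define r where "r = (\<Sum>k\<in>{1..N}. smult (poly p (gl_node N k)) (lagrange_poly N k))"
  have "p = r"
  proof (rule poly_eqI_degree[of "gl_node N ` {1..N}"])
    have card: "card (gl_node N ` {1..N}) = N" using gl_node_inj by (simp add: card_image)
    show "degree p < card (gl_node N ` {1..N})" using assms card by simp
    have "degree r < N" unfolding r_def
    proof (rule degree_sum_less)
      show "degree (smult (poly p (gl_node N k)) (lagrange_poly N k)) < N" if "k \<in> {1..N}" for k
        using degree_lagrange_poly[OF that] degree_smult_le le_less_trans by blast
    qed (use assms in auto)
    then show "degree r < card (gl_node N ` {1..N})" using card by simp
    fix t assume "t \<in> gl_node N ` {1..N}"
    then obtain i where i: "i \<in> {1..N}" "t = gl_node N i" by auto
    have "poly r t = (\<Sum>k\<in>{1..N}. if i = k then poly p (gl_node N k) else 0)"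
      unfolding r_def i(2) poly_sum poly_smult
      by (intro sum.cong refl) (subst lagrange_poly_node[OF _ i(1)], auto)
    also have "\<dots> = poly p t" using i by simp
    finally show "poly p t = poly r t" by simp
  qed
  then have "poly p = (\<lambda>t. \<Sum>k\<in>{1..N}. poly p (gl_node N k) * poly (lagrange_poly N k) t)"
    by (metis (no_types, lifting) ext poly_smult poly_sum r_def sum.cong)
  then have "integral {-1..1} (poly p) =
      integral {-1..1} (\<lambda>t. \<Sum>k\<in>{1..N}. poly p (gl_node N k) * poly (lagrange_poly N k) t)"
    by simp
  also have "\<dots> = (\<Sum>k\<in>{1..N}. poly p (gl_node N k) * integral {-1..1} (poly (lagrange_poly N k)))"
    by (subst integral_sum) (auto intro!: integrable_continuous_interval continuous_intros)
  finally show ?thesis by (simp add: gl_weight_eq mult.commute)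
qed

text \<open>Divide by the Legendre polynomial. The quotient has degree below N, so its product with
  \<open>legendre N\<close> integrates to 0 by orthogonality and also vanishes at the nodes; the
  remainder is covered by interpolation.\<close>

theorem gl_exact:
  assumes "degree p < 2 * N"
  shows "integral {-1..1} (poly p) = (\<Sum>k\<in>{1..N}. gl_weight N k * poly p (gl_node N k))"
proof -
  define q r where "q = p div legendre N" and "r = p mod legendre N"
  have N: "N > 0" using assms by simp
  then have nz: "legendre N \<noteq> 0" using degree_legendre[of N] by auto
  have p: "p = legendre N * q + r" by (simp add: q_def r_def)
  have r: "degree r < N"
    using degree_mod_less[OF nz, of p] N degree_legendre[of N] by (auto simp: r_def)
  have q: "degree q < N"
  proof (cases "q = 0")
    case False
    then have "degree (legendre N * q) = N + degree q"
      using nz by (simp add: degree_mult_eq degree_legendre)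
    moreover from this have "degree p = degree (legendre N * q)"
      unfolding p using r by (intro degree_add_eq_left) simp
    ultimately show ?thesis using assms by simp
  qed (use N in simp)
  have "poly p = (\<lambda>t. poly (legendre N * q) t + poly r t)"
    by (subst p) (simp add: fun_eq_iff)
  then have "integral {-1..1} (poly p) = integral {-1..1} (poly r)"
    by (simp add: integral_add[OF integrable_poly integrable_poly] legendre_orthogonal[OF q]
        del: poly_mult)
  also have "\<dots> = (\<Sum>k\<in>{1..N}. gl_weight N k * poly r (gl_node N k))"
    by (rule gl_exact_low[OF r])
  also have "\<dots> = (\<Sum>k\<in>{1..N}. gl_weight N k * poly p (gl_node N k))"
    by (intro sum.cong refl) (subst p, simp add: gl_node_root)
  finally show ?thesis .
qed

text \<open>The square of a Lagrange basis polynomial has degree at most 2N - 2, so the rule is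
  exact on it and returns precisely the weight, which is thus the integral of a square.\<close>

lemma gl_weight_nonneg:
  assumes "k \<in> {1..N}"
  shows "gl_weight N k \<ge> 0"
proof -
  let ?l = "lagrange_poly N k"
  have "degree (?l * ?l) < 2 * N"
    using degree_mult_le[of ?l ?l] degree_lagrange_poly[OF assms] by linarith
  then have "integral {-1..1} (poly (?l * ?l)) =
      (\<Sum>i\<in>{1..N}. gl_weight N i * poly (?l * ?l) (gl_node N i))"
    by (rule gl_exact)
  also have "\<dots> = (\<Sum>i\<in>{1..N}. if i = k then gl_weight N i else 0)"
    by (intro sum.cong refl) (simp add: lagrange_poly_node[OF assms])
  also have "\<dots> = gl_weight N k" using assms by simp
  finally show ?thesis
    by (metis integral_nonneg integrable_poly poly_mult zero_le_square)
qed

lemma gl_weight_sum: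
  assumes "N \<ge> 1"
  shows "(\<Sum>k\<in>{1..N}. gl_weight N k) = 2"
proof -
  have "poly (1::real poly) = (\<lambda>_. 1)" by (simp add: fun_eq_iff)
  then show ?thesis using gl_exact[of 1 N] assms by simp
qed

text \<open>Integral and rule agree on \<open>p\<close>. Each changes by at most 2\<delta> when
  \<open>p\<close> is replaced by \<open>f\<close>: the interval has length 2, and the nonnegative
  weights sum to 2.\<close>

theorem gl_error_le:
  assumes N: "N \<ge> 1" and p: "degree p < 2 * N"
    and f: "f integrable_on {-1..1}"
    and approx: "\<And>t. t \<in> {-1..1} \<Longrightarrow> \<bar>f t - poly p t\<bar> \<le> \<delta>"
  shows "\<bar>integral {-1..1} f - (\<Sum>k\<in>{1..N}. gl_weight N k * f (gl_node N k))\<bar> \<le> 4 * \<delta>"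
proof -
  have "norm (integral {-1..1} (\<lambda>t. f t - poly p t)) \<le> integral {-1..1} (\<lambda>t::real. \<delta>)"
    using approx by (intro integral_norm_bound_integral) (auto intro: integrable_diff f)
  then have I: "\<bar>integral {-1..1} f - integral {-1..1} (poly p)\<bar> \<le> 2 * \<delta>"
    by (simp add: integral_diff[OF f])
  have "\<bar>\<Sum>k\<in>{1..N}. gl_weight N k * (f (gl_node N k) - poly p (gl_node N k))\<bar> \<le>
      (\<Sum>k\<in>{1..N}. gl_weight N k * \<delta>)"
  proof (rule order_trans[OF sum_abs], rule sum_mono)
    fix k assume k: "k \<in> {1..N}"
    show "\<bar>gl_weight N k * (f (gl_node N k) - poly p (gl_node N k))\<bar> \<le> gl_weight N k * \<delta>"
      using gl_weight_nonneg[OF k] approx[of "gl_node N k"] gl_node_bounds[OF k]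
      by (simp add: abs_mult mult_left_mono)
  qed
  also have "\<dots> = 2 * \<delta>" using gl_weight_sum[OF N] by (simp add: sum_distrib_right[symmetric])
  finally show ?thesis
    using I by (simp add: gl_exact[OF p] sum_subtractf algebra_simps)
qed

section \<open>Chebyshev approximation of the kernel\<close>

fun chebyshev :: "nat \<Rightarrow> real poly" where
  "chebyshev 0 = 1"
| "chebyshev (Suc 0) = [:0, 1:]"
| "chebyshev (Suc (Suc n)) = [:0, 2:] * chebyshev (Suc n) - chebyshev n"

lemma degree_chebyshev_le: "degree (chebyshev n) \<le> n"
proof (induction n rule: chebyshev.induct)
  case (3 n)
  have "degree ([:0, 2:] * chebyshev (Suc n)) \<le> Suc (Suc n)"
    using degree_mult_le[of "[:0, 2:]" "chebyshev (Suc n)"] "3.IH"(1) by simp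
  then show ?case using "3.IH"(2) by (auto intro!: degree_diff_le)
qed auto

lemma chebyshev_cos: "poly (chebyshev n) (cos \<theta>) = cos (real n * \<theta>)"
proof (induction n rule: chebyshev.induct)
  case (3 n)
  have "cos (real (Suc (Suc n)) * \<theta>) + cos (real n * \<theta>) = 2 * cos \<theta> * cos (real (Suc n) * \<theta>)"
    using cos_add[of "real (Suc n) * \<theta>" \<theta>] cos_diff[of "real (Suc n) * \<theta>" \<theta>]
    by (simp add: algebra_simps)
  then show ?case using 3 by simp
qed auto

lemma abs_chebyshev_le:
  assumes "t \<in> {-1..1}"
  shows "\<bar>poly (chebyshev n) t\<bar> \<le> 1"
  using chebyshev_cos[of n "arccos t"] assms by (simp add: cos_arccos_abs abs_le_iff)

text \<open>The right-hand side obeys the Chebyshev recurrence. It shows the exponential growth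
  outside [-1,1], where the pole of the kernel lies.\<close>

lemma chebyshev_joukowski:
  assumes "r \<noteq> 0"
  shows "poly (chebyshev n) ((r + 1 / r) / 2) = (r ^ n + 1 / r ^ n) / 2"
proof (induction n rule: chebyshev.induct)
  case (3 n)
  have "r ^ Suc (Suc n) + 1 / r ^ Suc (Suc n) =
      (r + 1 / r) * (r ^ Suc n + 1 / r ^ Suc n) - (r ^ n + 1 / r ^ n)"
    using assms by (simp add: field_simps)
  then show ?case using 3 by simp
qed (use assms in auto)

section \<open>The kernel: integral, size and polynomial approximation\<close>

lemma phi1_denominator_pos:
  fixes t x :: real
  assumes "x > 0" "t \<in> {-1..1}"
  shows "2 + (t + 1) * (x - 1) > 0"
proof -
  have "2 + (t + 1) * (x - 1) = (1 - t) + (1 + t) * x" by (simp add: algebra_simps)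
  moreover have "(1 - t) + (1 + t) * x > 0"
    using assms by (cases "t = 1") (auto intro: add_pos_nonneg)
  ultimately show ?thesis by simp
qed

text \<open>The logarithm of the denominator is an antiderivative; its end values are ln(2x) and ln
  2.\<close>

lemma has_integral_phi1:
  fixes x :: real
  assumes "x > 0"
  shows "((\<lambda>t. phi1 t x) has_integral ln x) {-1..1}"
proof -
  have "((\<lambda>t. phi1 t x) has_integral
      (ln (2 + (1 + 1) * (x - 1)) - ln (2 + (- 1 + 1) * (x - 1)))) {-1..1}"
  proof (rule fundamental_theorem_of_calculus)
    fix t :: real assume "t \<in> {-1..1}"
    then have "2 + (t + 1) * (x - 1) > 0" using phi1_denominator_pos[OF assms] by simp
    then show "((\<lambda>t. ln (2 + (t + 1) * (x - 1))) has_vector_derivative phi1 t x)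
        (at t within {-1..1})"
      unfolding has_real_derivative_iff_has_vector_derivative[symmetric] phi1_def
      by (auto intro!: derivative_eq_intros)
  qed simp
  moreover have "ln (2 + (1 + 1) * (x - 1)) - ln (2 + (- 1 + 1) * (x - 1)) = ln x"
    using assms ln_mult[of 2 x] by simp
  ultimately show ?thesis by simp
qed

text \<open>The denominator is affine in t with end values 2 and 2x, hence at least 2 for x >= 1 and
  at least 2x for x < 1; the latter case uses 1/x <= M.\<close>

lemma abs_phi1_le:
  fixes t x :: real
  assumes "M > 1" "x \<in> range_R M" "t \<in> {-1..1}"
  shows "\<bar>phi1 t x\<bar> \<le> M / 2"
proof -
  have x: "x > 0" "x \<le> M" "1 \<le> M * x"
    using assms by (auto simp: range_R_def field_simps intro: less_le_trans[of 0 "1 / M"])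
  define D where "D = 2 + (t + 1) * (x - 1)"
  have D: "D > 0" unfolding D_def using phi1_denominator_pos[OF x(1) assms(3)] .
  have "2 * \<bar>x - 1\<bar> \<le> M * D"
  proof (cases "x \<ge> 1")
    case True
    then have "D \<ge> 2" using assms(3) by (simp add: D_def)
    then have "M * 2 \<le> M * D" using assms(1) by (intro mult_left_mono) auto
    moreover have "2 * \<bar>x - 1\<bar> \<le> M * 2" using True x(2) by simp
    ultimately show ?thesis by linarith
  next
    case False
    have "(1 - t) * (1 - x) \<ge> 0" using False assms(3) by (intro mult_nonneg_nonneg) auto
    then have "2 * x \<le> D" by (simp add: D_def algebra_simps)
    then have "M * (2 * x) \<le> M * D" using assms(1) by (intro mult_left_mono) auto
    moreover have "2 * \<bar>x - 1\<bar> \<le> M * (2 * x)" using False x by simp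
    ultimately show ?thesis by linarith
  qed
  moreover have "phi1 t x = (x - 1) / D" by (simp add: phi1_def D_def)
  ultimately show ?thesis using D by (simp add: abs_divide divide_le_eq mult.commute)
qed

text \<open>
  For \<open>c = (x+1)/(x-1)\<close> the polynomial \<open>q = T\<^sub>2\<^sub>N/T\<^sub>2\<^sub>N(-c)\<close> takes the value \<open>1\<close> at the pole \<open>-c\<close> of
  \<open>phi1 t x = 1/(t+c)\<close>, so \<open>(1-q(t))/(t+c)\<close> is a polynomial, and its relative error is \<open>q\<close>.
\<close>

lemma phi1_poly_approx:
  fixes x :: real
  assumes x: "x > 0" "x \<noteq> 1" and N: "N \<ge> 1"
  defines "r \<equiv> (sqrt x + 1) / (sqrt x - 1)"
  obtains p where "degree p < 2 * N"
    and "\<And>t. t \<in> {-1..1} \<Longrightarrow> \<bar>phi1 t x - poly p t\<bar> \<le> \<bar>phi1 t x\<bar> * (2 / r ^ (2 * N))"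
proof -
  define c where "c = (x + 1) / (x - 1)"
  define s where "s = sqrt x"
  have s: "s > 0" "s \<noteq> 1" "x = s * s" using x by (auto simp: s_def)
  have s1: "s * s - 1 \<noteq> 0" using s x by simp
  have r: "r \<noteq> 0" using s(1,2) unfolding r_def s_def[symmetric] by simp
  \<comment> \<open>\<open>-r\<close> is the Joukowski parameter of the pole \<open>-c\<close>: with
    s = sqrt x, r + 1/r = 2(s^2 + 1)/(s^2 - 1).\<close>
  have rc: "((- r) + 1 / (- r)) / 2 = - c"
  proof -
    have "r + 1 / r = 2 * c"
      unfolding r_def c_def s_def[symmetric] s(3) using s s1
      by (simp add: divide_simps) (simp add: algebra_simps)
    then show ?thesis by simp
  qed
  define T where "T = (r ^ (2 * N) + 1 / r ^ (2 * N)) / 2"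
  \<comment> \<open>The even degree disposes of all signs; \<open>r\<close> itself is negative for x
    < 1.\<close>
  have even: "(- r) ^ (2 * N) = r ^ (2 * N)" by simp
  have Tc: "poly (chebyshev (2 * N)) (- c) = T"
    using chebyshev_joukowski[of "- r" "2 * N"] r unfolding rc even T_def by simp
  have rpos: "r ^ (2 * N) > 0" using r by (simp add: zero_less_power_eq)
  have T: "T \<ge> r ^ (2 * N) / 2" "T > 0" using rpos by (auto simp: T_def add_pos_pos)
  define q where "q = smult (1 / T) (chebyshev (2 * N))"
  have dq: "degree (1 - q) \<le> 2 * N"
    unfolding q_def using degree_chebyshev_le[of "2 * N"]
    by (intro degree_diff_le order_trans[OF degree_smult_le]) auto
  have "poly (1 - q) (- c) = 0" using T Tc by (simp add: q_def)
  then have "[:c, 1:] dvd 1 - q" by (subst (asm) poly_eq_0_iff_dvd) simp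
  then obtain p where p: "1 - q = [:c, 1:] * p" by (elim dvdE)
  show thesis
  proof
    \<comment> \<open>Cancelling the linear factor at the pole brings degree 2N down to the range of
      exactness.\<close>
    show "degree p < 2 * N"
    proof (cases "p = 0")
      case False
      then have "degree (1 - q) = 1 + degree p" unfolding p by (subst degree_mult_eq) auto
      then show ?thesis using dq by simp
    qed (use N in simp)
    fix t :: real assume t: "t \<in> {-1..1}"
    have D: "2 + (t + 1) * (x - 1) > 0" using phi1_denominator_pos[OF x(1) t] .
    have Dc: "2 + (t + 1) * (x - 1) = (x - 1) * (c + t)"
      using x by (simp add: c_def field_simps)
    then have ct: "c + t \<noteq> 0" using D by auto
    have "phi1 t x = 1 / (c + t)" unfolding phi1_def Dc using x by simp
    moreover have "1 - poly q t = (c + t) * poly p t"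
      using arg_cong[OF p, of "\<lambda>p. poly p t"] by (simp add: algebra_simps)
    then have "poly p t = (1 - poly q t) / (c + t)" using ct by simp
    ultimately have "phi1 t x - poly p t = phi1 t x * poly q t"
      by (simp add: diff_divide_distrib)
    moreover have "\<bar>poly q t\<bar> \<le> 2 / r ^ (2 * N)"
    proof -
      have "\<bar>poly q t\<bar> = \<bar>poly (chebyshev (2 * N)) t\<bar> / T"
        using T by (simp add: q_def abs_mult)
      also have "\<dots> \<le> 1 / T" using abs_chebyshev_le[OF t] T by (intro divide_right_mono) auto
      also have "\<dots> \<le> 1 / (r ^ (2 * N) / 2)" using T rpos by (intro divide_left_mono) auto
      finally show ?thesis by simp
    qed
    ultimately show "\<bar>phi1 t x - poly p t\<bar> \<le> \<bar>phi1 t x\<bar> * (2 / r ^ (2 * N))"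
      by (simp only: abs_mult) (intro mult_left_mono, auto)
  qed
qed

text \<open>With m = sqrt M, the quantity is largest at the ends s = m and s = 1/m, where it equals
  (m - 1)/(m + 1) <= 1 - 1/m.\<close>

lemma inverse_joukowski_parameter_le:
  assumes M: "M > 1" and x: "x \<in> range_R M"
  shows "\<bar>(sqrt x - 1) / (sqrt x + 1)\<bar> \<le> exp (- 1 / sqrt M)"
proof -
  define m s where "m = sqrt M" and "s = sqrt x"
  have x0: "x > 0" using x M by (auto simp: range_R_def intro: less_le_trans[of 0 "1 / M"])
  have m: "m > 1" using M by (simp add: m_def)
  have s: "s > 0" "s \<le> m" using x x0 by (auto simp: m_def s_def range_R_def)
  have "1 / m \<le> s"
  proof -
    have "sqrt (1 / M) \<le> sqrt x" using x by (intro real_sqrt_le_mono) (auto simp: range_R_def)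
    then show ?thesis by (simp add: m_def s_def real_sqrt_divide)
  qed
  then have sm: "1 \<le> m * s" using m by (simp add: field_simps)
  \<comment> \<open>After expansion this is s <= m when s >= 1, and 1 <= m s when s < 1.\<close>
  have "\<bar>s - 1\<bar> * (m + 1) \<le> (m - 1) * (s + 1)"
    using s sm by (auto simp: abs_if algebra_simps)
  then have "\<bar>s - 1\<bar> / (s + 1) \<le> (m - 1) / (m + 1)" using s m by (simp add: field_simps)
  also have "\<dots> = 1 - 2 / (m + 1)" using m by (simp add: field_simps)
  also have "\<dots> \<le> 1 + (- 1 / m)" using m by (simp add: field_simps)
  also have "\<dots> \<le> exp (- 1 / m)" by (rule exp_ge_add_one_self)
  finally show ?thesis using s by (simp add: s_def m_def abs_divide)
qed

lemma gl_phi1_error: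
  assumes M: "M > 1" and x: "x \<in> range_R M" and N: "N \<ge> 1"
  shows "\<bar>ln x - (\<Sum>k\<in>{1..N}. gl_weight N k * phi1 (gl_node N k) x)\<bar> \<le>
    4 * (M * exp (- (2 * real N) / sqrt M))"
proof (cases "x = 1")
  \<comment> \<open>At x = 1 the kernel has no finite pole, but it vanishes identically, as does ln
    x.\<close>
  case True
  then show ?thesis using M by (simp add: phi1_def)
next
  case False
  define r where "r = (sqrt x + 1) / (sqrt x - 1)"
  have x0: "x > 0" using x M by (auto simp: range_R_def intro: less_le_trans[of 0 "1 / M"])
  obtain p where p: "degree p < 2 * N"
    "\<And>t. t \<in> {-1..1} \<Longrightarrow> \<bar>phi1 t x - poly p t\<bar> \<le> \<bar>phi1 t x\<bar> * (2 / r ^ (2 * N))"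
    using phi1_poly_approx[OF x0 False N] unfolding r_def by blast
  have "1 / r ^ (2 * N) = \<bar>(sqrt x - 1) / (sqrt x + 1)\<bar> ^ (2 * N)"
    by (simp add: r_def power_divide power_even_abs)
  also have "\<dots> \<le> exp (- 1 / sqrt M) ^ (2 * N)"
    using inverse_joukowski_parameter_le[OF M x] by (intro power_mono) auto
  also have "\<dots> = exp (- (2 * real N) / sqrt M)"
    by (simp add: exp_of_nat_mult[symmetric])
  finally have r: "1 / r ^ (2 * N) \<le> exp (- (2 * real N) / sqrt M)" .
  have "\<bar>phi1 t x - poly p t\<bar> \<le> M * exp (- (2 * real N) / sqrt M)" if t: "t \<in> {-1..1}" for t
  proof -
    have "\<bar>phi1 t x\<bar> * (2 / r ^ (2 * N)) \<le> M / 2 * (2 * exp (- (2 * real N) / sqrt M))"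
      using abs_phi1_le[OF M x t] r M by (intro mult_mono) auto
    then show ?thesis using p(2)[OF t] by simp
  qed
  then show ?thesis
    using gl_error_le[OF N p(1), of "\<lambda>t. phi1 t x" "M * exp (- (2 * real N) / sqrt M)"]
      has_integral_phi1[OF x0] by (auto simp: has_integral_iff)
qed

section \<open>The conic system\<close>

text \<open>Since (r1 + r2)^2 - (r1 - r2)^2 = 4 r1 r2, this is a rotated cone condition; the 8 in
  the first coordinate is 4 times 2.\<close>

lemma lorentz3_iff:
  assumes "r1 \<ge> 0" "r2 \<ge> 0" "t \<ge> -1"
  shows "vector [v * sqrt (8 * (t + 1)), r1 - r2, r1 + r2] \<in> lorentz3 \<longleftrightarrow>
    2 * (t + 1) * v\<^sup>2 \<le> r1 * r2"
proof -
  have "vector [v * sqrt (8 * (t + 1)), r1 - r2, r1 + r2] \<in> lorentz3 \<longleftrightarrow>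
      sqrt (v\<^sup>2 * (8 * (t + 1)) + (r1 - r2)\<^sup>2) \<le> r1 + r2"
    using assms by (simp add: lorentz3_def power_mult_distrib)
  also have "\<dots> \<longleftrightarrow> v\<^sup>2 * (8 * (t + 1)) + (r1 - r2)\<^sup>2 \<le> (r1 + r2)\<^sup>2"
    using assms sqrt_le_D real_le_lsqrt by (meson add_nonneg_nonneg)
  also have "\<dots> \<longleftrightarrow> 2 * (t + 1) * v\<^sup>2 \<le> r1 * r2"
  proof -
    have "(r1 + r2)\<^sup>2 - (v\<^sup>2 * (8 * (t + 1)) + (r1 - r2)\<^sup>2) = 4 * (r1 * r2 - 2 * (t + 1) * v\<^sup>2)"
      by (simp add: power2_eq_square algebra_simps)
    then show ?thesis
      by (metis diff_ge_0_iff_ge zero_le_mult_iff zero_le_numeral not_numeral_le_zero)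
  qed
  finally show ?thesis .
qed

text \<open>The terms quadratic in \<open>v\<close> cancel in r1 r2 - 2(t + 1)v^2, leaving (x - 1) -
  vD with D the denominator of the kernel. At v = (x - 1)/D one gets r1 = 2/D and r2 = (t + 1)(x -
  1)^2/D, so the sign conditions hold there.\<close>

lemma node_constraint:
  fixes t x v :: real
  assumes x: "x > 0" and t: "t \<in> {-1..1}"
  defines "r1 \<equiv> 1 - (t + 1) * v" and "r2 \<equiv> (x - 1) - 2 * v"
  shows "r1 \<ge> 0 \<Longrightarrow> r2 \<ge> 0 \<Longrightarrow>
      vector [v * sqrt (8 * (t + 1)), r1 - r2, r1 + r2] \<in> lorentz3 \<Longrightarrow> v \<le> phi1 t x"
    and "v = phi1 t x \<Longrightarrow> r1 \<ge> 0 \<and> r2 \<ge> 0 \<and>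
      vector [v * sqrt (8 * (t + 1)), r1 - r2, r1 + r2] \<in> lorentz3"
proof -
  define D where "D = 2 + (t + 1) * (x - 1)"
  have D: "D > 0" unfolding D_def using phi1_denominator_pos[OF x t] .
  have prod: "2 * (t + 1) * v\<^sup>2 \<le> r1 * r2 \<longleftrightarrow> v \<le> phi1 t x"
  proof -
    have "r1 * r2 - 2 * (t + 1) * v\<^sup>2 = (x - 1) - v * D"
      by (simp add: r1_def r2_def D_def power2_eq_square algebra_simps)
    then have "2 * (t + 1) * v\<^sup>2 \<le> r1 * r2 \<longleftrightarrow> v * D \<le> x - 1" by linarith
    then show ?thesis using D by (simp add: phi1_def D_def[symmetric] pos_le_divide_eq)
  qed
  show "v \<le> phi1 t x" if "r1 \<ge> 0" "r2 \<ge> 0"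
    "vector [v * sqrt (8 * (t + 1)), r1 - r2, r1 + r2] \<in> lorentz3"
    using that lorentz3_iff[OF that(1,2), of t v] t prod by simp
  assume v: "v = phi1 t x"
  then have vD: "v = (x - 1) / D" by (simp add: phi1_def D_def)
  have "r1 = 2 / D" using D unfolding r1_def vD by (simp add: field_simps) (simp add: D_def algebra_simps)
  moreover have "r2 = (t + 1) * (x - 1)\<^sup>2 / D"
    using D unfolding r2_def vD
    by (simp add: field_simps) (simp add: D_def algebra_simps power2_eq_square)
  ultimately have "r1 \<ge> 0" "r2 \<ge> 0" using D t by auto
  then show "r1 \<ge> 0 \<and> r2 \<ge> 0 \<and>
      vector [v * sqrt (8 * (t + 1)), r1 - r2, r1 + r2] \<in> lorentz3"
    using lorentz3_iff[of r1 r2 t v] t prod v by simp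
qed

lemma hatH_I:
  assumes "x \<in> range_R M" "(\<Sum>k\<in>{1..N}. gl_weight N k * v k) \<ge> \<nu>"
    and "\<And>k. k \<in> {1..N} \<Longrightarrow> 1 - (gl_node N k + 1) * v k \<ge> 0 \<and> (x - 1) - 2 * v k \<ge> 0 \<and>
      vector [v k * sqrt (8 * (gl_node N k + 1)),
        (1 - (gl_node N k + 1) * v k) - ((x - 1) - 2 * v k),
        (1 - (gl_node N k + 1) * v k) + ((x - 1) - 2 * v k)] \<in> lorentz3"
  shows "(x, \<nu>) \<in> hatH M N"
proof -
  have "\<exists>r1 r2. \<forall>k\<in>{1..N}. r1 k = 1 - (gl_node N k + 1) * v k \<and> r1 k \<ge> 0 \<and>
      r2 k = (x - 1) - 2 * v k \<and> r2 k \<ge> 0 \<and>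
      vector [v k * sqrt (8 * (gl_node N k + 1)), r1 k - r2 k, r1 k + r2 k] \<in> lorentz3"
    by (rule exI[of _ "\<lambda>k. 1 - (gl_node N k + 1) * v k"],
        rule exI[of _ "\<lambda>k. (x - 1) - 2 * v k"]) (use assms(3) in blast)
  then show ?thesis unfolding hatH_def using assms(1,2) by blast
qed

text \<open>Nonnegative weights turn the nodewise bounds on \<open>v\<close> into a bound on the
  sum, and taking every \<open>v k\<close> equal to its upper bound attains it.\<close>

lemma hatH_eq:
  assumes M: "M > 1"
  shows "hatH M N = {(x, \<nu>). x \<in> range_R M \<and>
    \<nu> \<le> (\<Sum>k\<in>{1..N}. gl_weight N k * phi1 (gl_node N k) x)}"
proof -
  have node: "gl_node N k \<in> {-1..1}" if "k \<in> {1..N}" for k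
    using gl_node_bounds[OF that] by auto
  have "(x, \<nu>) \<in> hatH M N \<longleftrightarrow> \<nu> \<le> (\<Sum>k\<in>{1..N}. gl_weight N k * phi1 (gl_node N k) x)"
    if x: "x \<in> range_R M" for x \<nu>
  proof
    have x0: "x > 0" using x M by (auto simp: range_R_def intro: less_le_trans[of 0 "1 / M"])
    {
      assume "(x, \<nu>) \<in> hatH M N"
      then obtain v r1 r2 where v: "(\<Sum>k\<in>{1..N}. gl_weight N k * v k) \<ge> \<nu>"
        and c: "\<And>k. k \<in> {1..N} \<Longrightarrow> r1 k = 1 - (gl_node N k + 1) * v k \<and> r1 k \<ge> 0 \<and>
          r2 k = (x - 1) - 2 * v k \<and> r2 k \<ge> 0 \<and>
          vector [v k * sqrt (8 * (gl_node N k + 1)), r1 k - r2 k, r1 k + r2 k] \<in> lorentz3"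
        unfolding hatH_def by blast
      have "v k \<le> phi1 (gl_node N k) x" if "k \<in> {1..N}" for k
        using c[OF that] node_constraint(1)[OF x0 node[OF that], of "v k"] by metis
      then have "(\<Sum>k\<in>{1..N}. gl_weight N k * v k) \<le>
          (\<Sum>k\<in>{1..N}. gl_weight N k * phi1 (gl_node N k) x)"
        by (intro sum_mono mult_left_mono gl_weight_nonneg)
      then show "\<nu> \<le> (\<Sum>k\<in>{1..N}. gl_weight N k * phi1 (gl_node N k) x)" using v by linarith
    }
    assume "\<nu> \<le> (\<Sum>k\<in>{1..N}. gl_weight N k * phi1 (gl_node N k) x)"
    then show "(x, \<nu>) \<in> hatH M N"
      using x node_constraint(2)[OF x0 node refl]
      by (intro hatH_I[where v = "\<lambda>k. phi1 (gl_node N k) x"]) auto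
  qed
  moreover have "x \<in> range_R M" if "(x, \<nu>) \<in> hatH M N" for x \<nu>
    using that unfolding hatH_def by blast
  ultimately show ?thesis by auto
qed

lemma soc_represents_hatH: "soc_represents (hatH_system M N) X Nu (hatH M N)"
proof -
  have sum: "(\<Sum>(a, u)\<leftarrow>map (\<lambda>k. (gl_weight N k, V k)) [1..<Suc N]. a * \<sigma> u) =
      (\<Sum>k\<in>{1..N}. gl_weight N k * \<sigma> (V k))" for \<sigma>
    by (simp add: o_def interv_sum_list_conv_sum_set_nat atLeastLessThanSuc_atLeastAtMost
        del: upt_Suc)
  have sat: "(\<forall>c\<in>set (hatH_system M N). sat \<sigma> c) \<longleftrightarrow> \<sigma> X \<in> range_R M \<and>
      (\<Sum>k\<in>{1..N}. gl_weight N k * \<sigma> (V k)) \<ge> \<sigma> Nu \<and>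
      (\<forall>k\<in>{1..N}.
         \<sigma> (R1 k) = 1 - (gl_node N k + 1) * \<sigma> (V k) \<and> \<sigma> (R1 k) \<ge> 0 \<and>
         \<sigma> (R2 k) = (\<sigma> X - 1) - 2 * \<sigma> (V k) \<and> \<sigma> (R2 k) \<ge> 0 \<and>
         vector [\<sigma> (V k) * sqrt (8 * (gl_node N k + 1)), \<sigma> (R1 k) - \<sigma> (R2 k),
           \<sigma> (R1 k) + \<sigma> (R2 k)] \<in> lorentz3)" for \<sigma>
  proof -
    have "(\<forall>c\<in>set (hatH_system M N). sat \<sigma> c) \<longleftrightarrow> \<sigma> X \<in> range_R M \<and>
      (\<Sum>k\<in>{1..N}. gl_weight N k * \<sigma> (V k)) \<ge> \<sigma> Nu \<and>
      (\<forall>k\<in>{1..N}. sat \<sigma> (Eq0 (Affine (- 1) [(1, R1 k), (gl_node N k + 1, V k)])) \<and>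
        sat \<sigma> (Ge0 (Affine 0 [(1, R1 k)])) \<and>
        sat \<sigma> (Eq0 (Affine 1 [(1, R2 k), (- 1, X), (2, V k)])) \<and>
        sat \<sigma> (Ge0 (Affine 0 [(1, R2 k)])) \<and>
        sat \<sigma> (InL3 (Affine 0 [(sqrt (8 * (gl_node N k + 1)), V k)])
             (Affine 0 [(1, R1 k), (- 1, R2 k)])
             (Affine 0 [(1, R1 k), (1, R2 k)])))"
      unfolding hatH_system_def
      using sum[of \<sigma>]
      by (auto simp: range_R_def atLeastLessThanSuc_atLeastAtMost simp del: upt_Suc)
    also have "\<dots> \<longleftrightarrow> \<sigma> X \<in> range_R M \<and>
      (\<Sum>k\<in>{1..N}. gl_weight N k * \<sigma> (V k)) \<ge> \<sigma> Nu \<and>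
      (\<forall>k\<in>{1..N}.
         \<sigma> (R1 k) = 1 - (gl_node N k + 1) * \<sigma> (V k) \<and> \<sigma> (R1 k) \<ge> 0 \<and>
         \<sigma> (R2 k) = (\<sigma> X - 1) - 2 * \<sigma> (V k) \<and> \<sigma> (R2 k) \<ge> 0 \<and>
         vector [\<sigma> (V k) * sqrt (8 * (gl_node N k + 1)), \<sigma> (R1 k) - \<sigma> (R2 k),
           \<sigma> (R1 k) + \<sigma> (R2 k)] \<in> lorentz3)"
      by (intro conj_cong ball_cong refl) (auto simp: mult.commute)
    finally show ?thesis .
  qed
  show ?thesis
    unfolding soc_represents_def
  proof (intro set_eqI iffI; clarify)
    fix x \<nu> assume "(x, \<nu>) \<in> hatH M N"
    then obtain v r1 r2 where *: "x \<in> range_R M"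
      "(\<Sum>k\<in>{1..N}. gl_weight N k * v k) \<ge> \<nu>"
      "\<forall>k\<in>{1..N}. r1 k = 1 - (gl_node N k + 1) * v k \<and> r1 k \<ge> 0 \<and>
          r2 k = (x - 1) - 2 * v k \<and> r2 k \<ge> 0 \<and>
          vector [v k * sqrt (8 * (gl_node N k + 1)), r1 k - r2 k, r1 k + r2 k] \<in> lorentz3"
      unfolding hatH_def by blast
    \<comment> \<open>The point and its three witness families are packed into one valuation; the
      converse inclusion reads them off again.\<close>
    define \<sigma> where "\<sigma> = (\<lambda>u. case u of X \<Rightarrow> x | Nu \<Rightarrow> \<nu> | V k \<Rightarrow> v k | R1 k \<Rightarrow> r1 k | R2 k \<Rightarrow> r2 k)"
    have "\<forall>c\<in>set (hatH_system M N). sat \<sigma> c" unfolding sat \<sigma>_def hvar.case using * by blast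
    then show "\<exists>\<sigma>. (x, \<nu>) = (\<sigma> X, \<sigma> Nu) \<and> (\<forall>c\<in>set (hatH_system M N). sat \<sigma> c)"
      by (intro exI[of _ \<sigma>]) (simp add: \<sigma>_def)
  next
    fix x \<nu> \<sigma> assume "\<forall>c\<in>set (hatH_system M N). sat \<sigma> c"
    then show "(\<sigma> X, \<sigma> Nu) \<in> hatH M N"
      unfolding sat hatH_def mem_Collect_eq prod.case
      by (elim conjE, intro conjI exI[of _ "\<lambda>k. \<sigma> (V k)"] exI[of _ "\<lambda>k. \<sigma> (R1 k)"]
          exI[of _ "\<lambda>k. \<sigma> (R2 k)"])
  qed
qed

lemma length_hatH_system: "length (hatH_system M N) = 3 + 5 * N"
  by (simp add: hatH_system_def length_concat o_def sum_list_triv del: upt_Suc)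

lemma card_system_vars_hatH_system: "card (system_vars (hatH_system M N)) \<le> 2 + 3 * N"
proof -
  have "system_vars (hatH_system M N) \<subseteq>
      {X, Nu} \<union> V ` {1..N} \<union> R1 ` {1..N} \<union> R2 ` {1..N}"
    by (auto simp: system_vars_def hatH_system_def simp del: upt_Suc)
  then have "card (system_vars (hatH_system M N)) \<le>
      card ({X, Nu} \<union> V ` {1..N} \<union> R1 ` {1..N} \<union> R2 ` {1..N})"
    by (intro card_mono) auto
  also have "\<dots> \<le> card {X, Nu} + card (V ` {1..N}) + card (R1 ` {1..N}) + card (R2 ` {1..N})"
    by (meson card_Un_le order_trans add_mono order_refl)
  also have "\<dots> \<le> 2 + N + N + N"
    using card_image_le[of "{1..N}" V] card_image_le[of "{1..N}" R1]
      card_image_le[of "{1..N}" R2] by (simp add: card_insert_if)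
  finally show ?thesis by simp
qed

section \<open>The bound on the ellipse\<close>

text \<open>Writing \<rho> = a + d, the gap is positive iff 2a\<rho> - \<rho>^2 - 1 = (a^2 - 1) -
  d^2 is, and a^2 - 1 = 4M/(M - 1)^2 exceeds 4/M = d^2.\<close>

lemma rho_bounds:
  assumes M: "M > 1"
  shows "rho M > 1" "(M + 1) / (M - 1) - rho M / 2 - inverse (rho M) / 2 > 0"
proof -
  define a d where "a = (M + 1) / (M - 1)" and "d = 2 / sqrt M"
  have a: "a > 1" using M by (simp add: a_def field_simps)
  have d: "d > 0" "d\<^sup>2 = 4 / M" using M by (auto simp: d_def power_divide)
  have rho: "rho M = a + d" by (simp add: rho_def a_def d_def)
  show gt: "rho M > 1" using a d by (simp add: rho)
  have "a\<^sup>2 - 1 = 4 * M / (M - 1)\<^sup>2"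
    using M by (simp add: a_def power_divide field_simps) (simp add: power2_eq_square algebra_simps)
  moreover have "4 / M < 4 * M / (M - 1)\<^sup>2"
  proof -
    have "(M - 1)\<^sup>2 < M * M" using M by (simp add: power2_eq_square algebra_simps)
    then show ?thesis using M by (simp add: divide_less_eq less_divide_eq)
  qed
  ultimately have "2 * a * rho M - (rho M)\<^sup>2 - 1 > 0"
    using d by (simp add: rho power2_eq_square algebra_simps)
  then have "(2 * a * rho M - (rho M)\<^sup>2 - 1) / (2 * rho M) > 0" using gt by simp
  also have "(2 * a * rho M - (rho M)\<^sup>2 - 1) / (2 * rho M) = a - rho M / 2 - inverse (rho M) / 2"
    using gt by (simp add: field_simps power2_eq_square)
  finally show "(M + 1) / (M - 1) - rho M / 2 - inverse (rho M) / 2 > 0" by (simp add: a_def)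
qed

lemma norm_ellipse_point_le:
  assumes "r > 0"
  shows "cmod (ellipse_point r \<theta>) \<le> r / 2 + inverse r / 2"
  unfolding ellipse_point_def
  by (rule order_trans[OF norm_triangle_ineq])
    (use assms in \<open>simp add: norm_mult norm_inverse norm_divide\<close>)

text \<open>The poles stay at distance at least \<open>a\<close> from 0, while the ellipse lies in
  the disc whose radius is its semi-major axis \<open>E\<close>. The reverse triangle inequality
  then bounds the denominator below by (a - E)|x - 1|, and L = 1/(a - E).\<close>

lemma phi1_ellipse_bound:
  assumes M: "M > 1" and x: "x \<in> range_R M"
  shows "2 + (ellipse_point (rho M) \<theta> + 1) * (of_real x - 1) \<noteq> 0"
    and "cmod (phi1 (ellipse_point (rho M) \<theta>) (of_real x)) \<le> bound_L M"
proof -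
  let ?z = "ellipse_point (rho M) \<theta>"
  define a E where "a = (M + 1) / (M - 1)" and "E = rho M / 2 + inverse (rho M) / 2"
  define D where "D = 2 + (?z + 1) * (of_real x - 1)"
  have aE: "a - E > 0" using rho_bounds(2)[OF M] unfolding a_def E_def by linarith
  have L: "bound_L M = 1 / (a - E)" unfolding bound_L_def a_def E_def by (simp only: diff_diff_eq)
  have z: "cmod ?z \<le> E" unfolding E_def using rho_bounds(1)[OF M] by (intro norm_ellipse_point_le) simp
  have x0: "x > 0" "x \<le> M" "1 \<le> M * x"
    using x M by (auto simp: range_R_def field_simps intro: less_le_trans[of 0 "1 / M"])
  \<comment> \<open>The pole -(x + 1)/(x - 1) has modulus at least \<open>a\<close>, with equality
    at x = M and x = 1/M.\<close>
  have ax: "a * \<bar>x - 1\<bar> \<le> x + 1"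
    using M x0 by (auto simp: a_def abs_if field_simps)
  have "D = of_real (x + 1) + ?z * of_real (x - 1)" by (simp add: D_def algebra_simps)
  then have "cmod D \<ge> cmod (of_real (x + 1)) - cmod (?z * of_real (x - 1))"
    by (metis norm_diff_ineq)
  moreover have "cmod (?z * of_real (x - 1)) \<le> E * \<bar>x - 1\<bar>"
    unfolding norm_mult norm_of_real using z by (intro mult_right_mono) auto
  moreover have "cmod (of_real (x + 1)) = x + 1" using x0 unfolding norm_of_real by simp
  ultimately have "cmod D \<ge> x + 1 - E * \<bar>x - 1\<bar>" by linarith
  then have D: "cmod D \<ge> (a - E) * \<bar>x - 1\<bar>" using ax by (simp add: algebra_simps)
  have nz: "D \<noteq> 0"
  proof (cases "x = 1")
    case False
    then have "(a - E) * \<bar>x - 1\<bar> > 0" using aE by simp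
    then show ?thesis using D by auto
  qed (simp add: D_def)
  then show "2 + (?z + 1) * (of_real x - 1) \<noteq> 0" by (simp add: D_def)
  have "cmod (of_real x - 1) = \<bar>x - 1\<bar>" by (metis norm_of_real of_real_1 of_real_diff)
  then have "cmod (phi1 ?z (of_real x)) = \<bar>x - 1\<bar> / cmod D"
    by (simp add: phi1_def D_def norm_divide)
  also have "\<dots> \<le> 1 / (a - E)" using D nz aE by (simp add: field_simps)
  finally show "cmod (phi1 ?z (of_real x)) \<le> bound_L M" by (simp add: L)
qed

section \<open>The number of points\<close>

text \<open>Obtained by solving 4M exp(-2N/sqrt M) <= \<epsilon> for N. The logarithm is negative
  for \<epsilon> > 4M, where \<open>nat\<close> gives 0; \<open>Suc\<close> keeps at least one
  node.\<close>

definition num_points :: "real \<Rightarrow> real \<Rightarrow> nat" where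
  "num_points M \<epsilon> = Suc (nat \<lceil>sqrt M / 2 * ln (4 * M / \<epsilon>)\<rceil>)"

lemma num_points_error:
  assumes M: "M > 1" and e: "\<epsilon> > 0"
  shows "4 * (M * exp (- (2 * real (num_points M \<epsilon>)) / sqrt M)) \<le> \<epsilon>"
proof -
  have "sqrt M / 2 * ln (4 * M / \<epsilon>) \<le> real (num_points M \<epsilon>)"
    unfolding num_points_def by linarith
  then have "ln (4 * M / \<epsilon>) \<le> 2 * real (num_points M \<epsilon>) / sqrt M"
    using M by (simp add: field_simps)
  then have "exp (- (2 * real (num_points M \<epsilon>)) / sqrt M) \<le> exp (- ln (4 * M / \<epsilon>))" by simp
  also have "\<dots> = \<epsilon> / (4 * M)" using M e by (simp add: exp_minus)
  finally show ?thesis using M by (simp add: field_simps)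
qed

text \<open>For P = M^3/\<epsilon> >= 4, 4M/\<epsilon> <= 4P <= P^2 bounds the logarithm by 2 ln P.
  Also sqrt M ln P >= 1, which absorbs the additive constant.\<close>

lemma num_points_le:
  assumes M: "M > 1" and e: "\<epsilon> > 0" and P: "M ^ 3 / \<epsilon> \<ge> 4"
  shows "real (num_points M \<epsilon>) \<le> 6 * (sqrt M * ln (sqrt (M ^ 3 / \<epsilon>)))"
proof -
  define P where "P = M ^ 3 / \<epsilon>"
  have P4: "P \<ge> 4" using P by (simp add: P_def)
  have lnP: "ln P \<ge> 1"
  proof -
    have "exp 1 \<le> P" using exp_le P4 by linarith
    then show ?thesis using P4 by (simp add: ln_ge_iff)
  qed
  have s: "sqrt M \<ge> 1" using M by simp
  have sP: "sqrt M * ln P \<ge> 1" using mult_mono[OF s lnP] s by simp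
  have "M \<le> M ^ 3" using M by (simp add: self_le_power)
  then have "4 * M / \<epsilon> \<le> 4 * P" using e by (simp add: P_def divide_right_mono)
  also have "\<dots> \<le> P * P" using P4 by (intro mult_right_mono) auto
  finally have "ln (4 * M / \<epsilon>) \<le> ln (P * P)" using M e P4 by (subst ln_le_cancel_iff) auto
  also have "\<dots> = 2 * ln P" using P4 by (simp add: ln_mult)
  finally have "sqrt M / 2 * ln (4 * M / \<epsilon>) \<le> sqrt M / 2 * (2 * ln P)"
    using s by (intro mult_left_mono) auto
  then have "sqrt M / 2 * ln (4 * M / \<epsilon>) \<le> sqrt M * ln P" by simp
  \<comment> \<open>The 2 accounts for \<open>Suc\<close> and for rounding up.\<close>
  then have "real (num_points M \<epsilon>) \<le> 2 + sqrt M * ln P"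
    unfolding num_points_def using sP by linarith
  also have "\<dots> \<le> 3 * (sqrt M * ln P)" using sP by simp
  also have "\<dots> = 6 * (sqrt M * ln (sqrt P))" using P4 by (simp add: ln_sqrt)
  finally show ?thesis by (simp add: P_def)
qed

text \<open>Stated for any multiple of the number of points, so that it also covers the counts of
  variables and constraints.\<close>

lemma bigo_growth_num_points:
  assumes "\<And>M \<epsilon>. 0 \<le> f (M, \<epsilon>)" "\<And>M \<epsilon>. f (M, \<epsilon>) \<le> C * real (num_points M \<epsilon>)" "C \<ge> 0"
  shows "f \<in> O[growth](\<lambda>(M, \<epsilon>). sqrt M * ln (sqrt (M ^ 3 / \<epsilon>)))"
proof (rule bigoI[of _ "C * 6"])
  show "\<forall>\<^sub>F z in growth. norm (f z) \<le>
      C * 6 * norm (case z of (M, \<epsilon>) \<Rightarrow> sqrt M * ln (sqrt (M ^ 3 / \<epsilon>)))"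
    unfolding eventually_growth
  proof (intro exI[of _ 4] allI impI)
    fix M \<epsilon> :: real assume *: "M > 1" "\<epsilon> > 0" "M ^ 3 / \<epsilon> \<ge> 4"
    have "C * real (num_points M \<epsilon>) \<le> C * (6 * (sqrt M * ln (sqrt (M ^ 3 / \<epsilon>))))"
      using num_points_le[OF *] assms(3) by (intro mult_left_mono)
    also have "\<dots> \<le> C * (6 * \<bar>sqrt M * ln (sqrt (M ^ 3 / \<epsilon>))\<bar>)"
      using assms(3) by (intro mult_left_mono) auto
    finally show "norm (f (M, \<epsilon>)) \<le>
        C * 6 * norm (case (M, \<epsilon>) of (M, \<epsilon>) \<Rightarrow> sqrt M * ln (sqrt (M ^ 3 / \<epsilon>)))"
      using assms(1)[of M \<epsilon>] assms(2)[of M \<epsilon>] by simp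
  qed
qed

theorem corollary1:
  shows
    "(\<forall>M>1. rho M > 1 \<and> 0 < bound_L M \<and>
        (\<forall>x\<in>range_R M. \<forall>\<theta>\<in>{0..2 * pi}.
           2 + (ellipse_point (rho M) \<theta> + 1) * (of_real x - 1) \<noteq> 0 \<and>
           cmod (phi1 (ellipse_point (rho M) \<theta>) (of_real x)) \<le> bound_L M)) \<and>
     (\<exists>N :: real \<Rightarrow> real \<Rightarrow> nat.
        (\<forall>M>1. \<forall>\<epsilon>>0. N M \<epsilon> \<ge> 1 \<and>
           hyp_log M (- \<epsilon>) \<subseteq> hatH M (N M \<epsilon>) \<and> hatH M (N M \<epsilon>) \<subseteq> hyp_log M \<epsilon> \<and>
           soc_represents (hatH_system M (N M \<epsilon>)) X Nu (hatH M (N M \<epsilon>))) \<and>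
        (\<lambda>(M, \<epsilon>). real (N M \<epsilon>))
           \<in> O[growth](\<lambda>(M, \<epsilon>). sqrt M * ln (sqrt (M ^ 3 / \<epsilon>))) \<and>
        (\<lambda>(M, \<epsilon>). real (card (system_vars (hatH_system M (N M \<epsilon>)))))
           \<in> O[growth](\<lambda>(M, \<epsilon>). sqrt M * ln (sqrt (M ^ 3 / \<epsilon>))) \<and>
        (\<lambda>(M, \<epsilon>). real (length (hatH_system M (N M \<epsilon>))))
           \<in> O[growth](\<lambda>(M, \<epsilon>). sqrt M * ln (sqrt (M ^ 3 / \<epsilon>))))"
proof (intro conjI allI impI ballI exI[of _ num_points])
  fix M :: real assume M: "M > 1"
  show "rho M > 1" using rho_bounds(1)[OF M] .
  show "0 < bound_L M" using rho_bounds(2)[OF M] by (simp add: bound_L_def)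
  fix x \<theta> assume x: "x \<in> range_R M"
  show "2 + (ellipse_point (rho M) \<theta> + 1) * (of_real x - 1) \<noteq> 0"
    "cmod (phi1 (ellipse_point (rho M) \<theta>) (of_real x)) \<le> bound_L M"
    using phi1_ellipse_bound[OF M x] by auto
next
  fix M \<epsilon> :: real assume M: "M > 1" and e: "\<epsilon> > 0"
  show N: "num_points M \<epsilon> \<ge> 1" by (simp add: num_points_def)
  let ?Q = "\<lambda>x. \<Sum>k\<in>{1..num_points M \<epsilon>}.
    gl_weight (num_points M \<epsilon>) k * phi1 (gl_node (num_points M \<epsilon>) k) x"
  \<comment> \<open>The upper bound on ln x - Q(x) gives the first inclusion, the lower bound the
    second.\<close>
  have err: "\<bar>ln x - ?Q x\<bar> \<le> \<epsilon>" if "x \<in> range_R M" for x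
    using gl_phi1_error[OF M that N] num_points_error[OF M e] by (rule order_trans)
  show "hyp_log M (- \<epsilon>) \<subseteq> hatH M (num_points M \<epsilon>)"
    unfolding hatH_eq[OF M] hyp_log_def using err by (fastforce simp: abs_le_iff)
  show "hatH M (num_points M \<epsilon>) \<subseteq> hyp_log M \<epsilon>"
    unfolding hatH_eq[OF M] hyp_log_def using err by (fastforce simp: abs_le_iff)
  show "soc_represents (hatH_system M (num_points M \<epsilon>)) X Nu (hatH M (num_points M \<epsilon>))"
    by (rule soc_represents_hatH)
next
  show "(\<lambda>(M, \<epsilon>). real (num_points M \<epsilon>))
      \<in> O[growth](\<lambda>(M, \<epsilon>). sqrt M * ln (sqrt (M ^ 3 / \<epsilon>)))"
    by (rule bigo_growth_num_points[of _ 1]) auto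
  \<comment> \<open>As N >= 1, 2 + 3N <= 5N; likewise 3 + 5N <= 8N for the constraints
    below.\<close>
  have "real (card (system_vars (hatH_system M (num_points M \<epsilon>)))) \<le> 5 * real (num_points M \<epsilon>)"
    for M \<epsilon>
    using card_system_vars_hatH_system[of M "num_points M \<epsilon>"] by (simp add: num_points_def)
  then show "(\<lambda>(M, \<epsilon>). real (card (system_vars (hatH_system M (num_points M \<epsilon>)))))
      \<in> O[growth](\<lambda>(M, \<epsilon>). sqrt M * ln (sqrt (M ^ 3 / \<epsilon>)))"
    by (intro bigo_growth_num_points[of _ 5]) auto
  show "(\<lambda>(M, \<epsilon>). real (length (hatH_system M (num_points M \<epsilon>))))
      \<in> O[growth](\<lambda>(M, \<epsilon>). sqrt M * ln (sqrt (M ^ 3 / \<epsilon>)))"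
    by (rule bigo_growth_num_points[of _ 8]) (auto simp: length_hatH_system num_points_def)
qed

end
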